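(* Let $Q$ be a commutative RIF loop. Then: (i) for each $x\in Q$, $x^3\in C_0(Q)$; (ii) $C_0(Q)$ is a normal subloop of $Q$; (iii) $Q/C_0(Q)$ is a Moufang loop of exponent $3$.
   Context: A loop is a set $Q$ with a binary operation with neutral element $1$ such that for all $a,b\in Q$ the equations $ax=b$ and $ya=b$ have unique solutions $x,y\in Q$. A loop is an inverse property (IP) loop if each $x$ has a (two-sided) inverse $x^{-1}$ with $x^{-1}(xy)=y$ and $(yx)x^{-1}=y$ for all $y$. A RIF loop is an IP loop satisfying either, and hence both, of the (equivalent) identities $((xy)z)(xy)=x(y((zx)y))$ and $(xy)(z(xy))=((x(yz))x)y$. It is known that RIF loops are diassociative, i.e., any two elements generate a subgroup; so powers are well defined. $C_0(Q)$ is the set of C elements of $Q$, i.e., all $c\in Q$ such that $x(c(cy))=((xc)c)y$ for all $x,y\in Q$. A subloop is normal if it is the kernel of some loop homomorphism defined on $Q$. A Moufang loop is a loop satisfying any, and hence all, of the equivalent identities $x((yz)x)=(xy)(zx)$, $(x(yz))x=(xy)(zx)$, $x(y(xz))=((xy)x)z$, $((zx)y)x=z(x(yx))$. A loop has exponent $n$ if $x^n=1$ for all its elements $x$. *)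

theory Defs
  imports "HOL-Algebra.Coset"
begin

text \<open>Loops are records of type \<^typ>\<open>('a, 'b) monoid_scheme\<close>, so that the notation, powers,
  homomorphisms, kernels and factor structures of HOL-Algebra apply to them. All of these are
  defined there without reference to associativity. In a loop without associativity,
  \<open>x [^] (n::nat)\<close> is the left-nested product \<open>((x \<otimes> x) \<otimes> x) \<dots>\<close>.\<close>

locale loop =
  fixes Q :: "('a, 'b) monoid_scheme" (structure)
  assumes m_closed: "\<lbrakk>x \<in> carrier Q; y \<in> carrier Q\<rbrakk> \<Longrightarrow> x \<otimes> y \<in> carrier Q"
    and one_closed: "\<one> \<in> carrier Q"
    and l_one: "x \<in> carrier Q \<Longrightarrow> \<one> \<otimes> x = x"
    and r_one: "x \<in> carrier Q \<Longrightarrow> x \<otimes> \<one> = x"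
    and l_div: "\<lbrakk>a \<in> carrier Q; b \<in> carrier Q\<rbrakk> \<Longrightarrow> \<exists>!x. x \<in> carrier Q \<and> a \<otimes> x = b"
    and r_div: "\<lbrakk>a \<in> carrier Q; b \<in> carrier Q\<rbrakk> \<Longrightarrow> \<exists>!y. y \<in> carrier Q \<and> y \<otimes> a = b"

locale commutative_loop = loop +
  assumes m_comm: "\<lbrakk>x \<in> carrier Q; y \<in> carrier Q\<rbrakk> \<Longrightarrow> x \<otimes> y = y \<otimes> x"

locale IP_loop = loop +
  assumes inverse_property:
    "x \<in> carrier Q \<Longrightarrow> \<exists>x'\<in>carrier Q. x' \<otimes> x = \<one> \<and> x \<otimes> x' = \<one> \<and>
       (\<forall>y\<in>carrier Q. x' \<otimes> (x \<otimes> y) = y \<and> (y \<otimes> x) \<otimes> x' = y)"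

text \<open>In an IP loop each of the two identities below implies the other.\<close>

locale RIF_loop = IP_loop +
  assumes RIF:
    "(\<forall>x\<in>carrier Q. \<forall>y\<in>carrier Q. \<forall>z\<in>carrier Q.
        ((x \<otimes> y) \<otimes> z) \<otimes> (x \<otimes> y) = x \<otimes> (y \<otimes> ((z \<otimes> x) \<otimes> y))) \<or>
     (\<forall>x\<in>carrier Q. \<forall>y\<in>carrier Q. \<forall>z\<in>carrier Q.
        (x \<otimes> y) \<otimes> (z \<otimes> (x \<otimes> y)) = ((x \<otimes> (y \<otimes> z)) \<otimes> x) \<otimes> y)"

text \<open>In a loop each of the following four identities implies the others.\<close>

locale Moufang_loop = loop +
  assumes Moufang:
    "\<lbrakk>x \<in> carrier Q; y \<in> carrier Q; z \<in> carrier Q\<rbrakk> \<Longrightarrow> x \<otimes> ((y \<otimes> z) \<otimes> x) = (x \<otimes> y) \<otimes> (z \<otimes> x)"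
    "\<lbrakk>x \<in> carrier Q; y \<in> carrier Q; z \<in> carrier Q\<rbrakk> \<Longrightarrow> (x \<otimes> (y \<otimes> z)) \<otimes> x = (x \<otimes> y) \<otimes> (z \<otimes> x)"
    "\<lbrakk>x \<in> carrier Q; y \<in> carrier Q; z \<in> carrier Q\<rbrakk> \<Longrightarrow> x \<otimes> (y \<otimes> (x \<otimes> z)) = ((x \<otimes> y) \<otimes> x) \<otimes> z"
    "\<lbrakk>x \<in> carrier Q; y \<in> carrier Q; z \<in> carrier Q\<rbrakk> \<Longrightarrow> ((z \<otimes> x) \<otimes> y) \<otimes> x = z \<otimes> (x \<otimes> (y \<otimes> x))"

definition has_exponent :: "('a, 'b) monoid_scheme \<Rightarrow> nat \<Rightarrow> bool"
  where "has_exponent Q n \<longleftrightarrow> (\<forall>x\<in>carrier Q. x [^]\<^bsub>Q\<^esub> n = \<one>\<^bsub>Q\<^esub>)"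

definition C_elements :: "('a, 'b) monoid_scheme \<Rightarrow> 'a set"  (\<open>C\<^sub>0\<close>)
  where "C\<^sub>0 Q = {c \<in> carrier Q. \<forall>x\<in>carrier Q. \<forall>y\<in>carrier Q.
           x \<otimes>\<^bsub>Q\<^esub> (c \<otimes>\<^bsub>Q\<^esub> (c \<otimes>\<^bsub>Q\<^esub> y)) = ((x \<otimes>\<^bsub>Q\<^esub> c) \<otimes>\<^bsub>Q\<^esub> c) \<otimes>\<^bsub>Q\<^esub> y}"

definition subloop :: "'a set \<Rightarrow> ('a, 'b) monoid_scheme \<Rightarrow> bool"
  where "subloop H Q \<longleftrightarrow> H \<subseteq> carrier Q \<and> loop (Q\<lparr>carrier := H\<rparr>)"

text \<open>HOL cannot quantify over the type of the codomain of the homomorphism, so the codomain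
  is taken on the type \<^typ>\<open>'a set\<close>, which accommodates every homomorphic image of \<open>Q\<close>.
  By lemma \<open>kernel_normal_subloop\<close> below this is no restriction. For a normal subloop \<open>N\<close>,
  the factor loop is \<open>Q Mod N\<close>: its elements are the cosets of \<open>N\<close>, and the elementwise
  product \<open>(N #> a) <#> (N #> b)\<close> is the coset \<open>N #> (a \<otimes> b)\<close>.\<close>

definition normal_subloop :: "'a set \<Rightarrow> ('a, 'b) monoid_scheme \<Rightarrow> bool"
  where "normal_subloop N Q \<longleftrightarrow> subloop N Q \<and>
     (\<exists>(L :: 'a set monoid) h. loop L \<and> h \<in> hom Q L \<and> N = kernel Q L h)"

lemma (in loop) l_cancel:
  "\<lbrakk>a \<in> carrier Q; x \<in> carrier Q; y \<in> carrier Q; a \<otimes> x = a \<otimes> y\<rbrakk> \<Longrightarrow> x = y"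
  using l_div[of a "a \<otimes> x"] m_closed by metis

lemma (in loop) r_cancel:
  "\<lbrakk>a \<in> carrier Q; x \<in> carrier Q; y \<in> carrier Q; x \<otimes> a = y \<otimes> a\<rbrakk> \<Longrightarrow> x = y"
  using r_div[of a "x \<otimes> a"] m_closed by metis

lemma loop_hom_one:
  assumes "loop Q" "loop L" "h \<in> hom Q L"
  shows "h \<one>\<^bsub>Q\<^esub> = \<one>\<^bsub>L\<^esub>"
proof -
  interpret Q: loop Q by fact
  interpret L: loop L by fact
  have c: "h \<one>\<^bsub>Q\<^esub> \<in> carrier L" using assms(3) Q.one_closed by (rule hom_in_carrier)
  have "h \<one>\<^bsub>Q\<^esub> \<otimes>\<^bsub>L\<^esub> h \<one>\<^bsub>Q\<^esub> = h \<one>\<^bsub>Q\<^esub> \<otimes>\<^bsub>L\<^esub> \<one>\<^bsub>L\<^esub>"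
    using hom_mult[OF assms(3) Q.one_closed Q.one_closed] Q.one_closed c
    by (simp add: Q.l_one L.r_one)
  then show ?thesis using L.l_cancel c L.one_closed by blast
qed

lemma kernel_subloop:
  assumes "loop Q" "loop L" "h \<in> hom Q L"
  shows "subloop (kernel Q L h) Q"
proof -
  interpret Q: loop Q by fact
  interpret L: loop L by fact
  have hc: "\<And>x. x \<in> carrier Q \<Longrightarrow> h x \<in> carrier L" using assms(3) by (rule hom_in_carrier)
  have hm: "\<And>x y. \<lbrakk>x \<in> carrier Q; y \<in> carrier Q\<rbrakk> \<Longrightarrow> h (x \<otimes>\<^bsub>Q\<^esub> y) = h x \<otimes>\<^bsub>L\<^esub> h y"
    using assms(3) by (rule hom_mult)
  have l: "h x = \<one>\<^bsub>L\<^esub>"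
    if "a \<in> carrier Q" "x \<in> carrier Q" "h a = \<one>\<^bsub>L\<^esub>" "h (a \<otimes>\<^bsub>Q\<^esub> x) = \<one>\<^bsub>L\<^esub>" for a x
    using that hm[of a x] hc[of x] by (simp add: L.l_one)
  have r: "h x = \<one>\<^bsub>L\<^esub>"
    if "a \<in> carrier Q" "x \<in> carrier Q" "h a = \<one>\<^bsub>L\<^esub>" "h (x \<otimes>\<^bsub>Q\<^esub> a) = \<one>\<^bsub>L\<^esub>" for a x
    using that hm[of x a] hc[of x] by (simp add: L.r_one)
  have "loop (Q\<lparr>carrier := kernel Q L h\<rparr>)"
  proof (unfold_locales, goal_cases)
    case (5 a b)
    then show ?case using Q.l_div[of a b] l[of a] unfolding kernel_def by auto
  next
    case (6 a b)
    then show ?case using Q.r_div[of a b] r[of a] unfolding kernel_def by auto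
  qed (auto simp: kernel_def hm Q.m_closed Q.one_closed Q.l_one Q.r_one L.l_one L.one_closed
        loop_hom_one[OF assms])
  then show ?thesis by (auto simp: subloop_def kernel_def)
qed

lemma kernel_normal_subloop:
  fixes Q :: "('a, 'b) monoid_scheme" and L :: "('c, 'd) monoid_scheme"
  assumes "loop Q" "loop L" "h \<in> hom Q L"
  shows "normal_subloop (kernel Q L h) Q"
proof -
  interpret Q: loop Q by fact
  interpret L: loop L by fact
  have hc: "\<And>x. x \<in> carrier Q \<Longrightarrow> h x \<in> carrier L" using assms(3) by (rule hom_in_carrier)
  have hm: "\<And>x y. \<lbrakk>x \<in> carrier Q; y \<in> carrier Q\<rbrakk> \<Longrightarrow> h (x \<otimes>\<^bsub>Q\<^esub> y) = h x \<otimes>\<^bsub>L\<^esub> h y"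
    using assms(3) by (rule hom_mult)
  define fib where "fib a = {y \<in> carrier Q. h y = h a}" for a
  define rep where "rep A = (SOME a. a \<in> carrier Q \<and> A = fib a)" for A
  define M :: "'a set monoid" where
    "M = \<lparr>carrier = fib ` carrier Q, mult = (\<lambda>A B. fib (rep A \<otimes>\<^bsub>Q\<^esub> rep B)), one = fib \<one>\<^bsub>Q\<^esub>\<rparr>"
  have fib_eq: "fib a = fib b \<longleftrightarrow> h a = h b" if "a \<in> carrier Q" "b \<in> carrier Q" for a b
    using that unfolding fib_def by auto
  have rep: "rep (fib a) \<in> carrier Q \<and> fib a = fib (rep (fib a))" if "a \<in> carrier Q" for a
    unfolding rep_def by (rule someI[of _ a]) (use that in simp)
  then have hrep: "h (rep (fib a)) = h a" if "a \<in> carrier Q" for a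
    using fib_eq that by metis
  have mult: "fib a \<otimes>\<^bsub>M\<^esub> fib b = fib (a \<otimes>\<^bsub>Q\<^esub> b)" if "a \<in> carrier Q" "b \<in> carrier Q" for a b
    using that rep by (simp add: M_def fib_eq Q.m_closed hm hrep)
  have car: "carrier M = fib ` carrier Q" and one: "\<one>\<^bsub>M\<^esub> = fib \<one>\<^bsub>Q\<^esub>"
    by (simp_all add: M_def)
  have "loop M"
  proof (unfold_locales, goal_cases)
    case (5 A B)
    then obtain a b where a: "a \<in> carrier Q" "A = fib a" and b: "b \<in> carrier Q" "B = fib b"
      by (auto simp: car)
    obtain x where x: "x \<in> carrier Q" "a \<otimes>\<^bsub>Q\<^esub> x = b" using Q.l_div a b by blast
    show ?case
    proof (rule ex1I[of _ "fib x"])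
      fix X assume "X \<in> carrier M \<and> A \<otimes>\<^bsub>M\<^esub> X = B"
      then obtain z where z: "z \<in> carrier Q" "X = fib z" "fib a \<otimes>\<^bsub>M\<^esub> fib z = fib b"
        using a b by (auto simp: car)
      then have "h a \<otimes>\<^bsub>L\<^esub> h z = h a \<otimes>\<^bsub>L\<^esub> h x"
        using a b x by (metis mult fib_eq hm Q.m_closed)
      then show "X = fib x" using z x a L.l_cancel hc fib_eq by metis
    qed (use a b x in \<open>auto simp: car mult\<close>)
  next
    case (6 A B)
    then obtain a b where a: "a \<in> carrier Q" "A = fib a" and b: "b \<in> carrier Q" "B = fib b"
      by (auto simp: car)
    obtain x where x: "x \<in> carrier Q" "x \<otimes>\<^bsub>Q\<^esub> a = b" using Q.r_div a b by blast
    show ?case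
    proof (rule ex1I[of _ "fib x"])
      fix X assume "X \<in> carrier M \<and> X \<otimes>\<^bsub>M\<^esub> A = B"
      then obtain z where z: "z \<in> carrier Q" "X = fib z" "fib z \<otimes>\<^bsub>M\<^esub> fib a = fib b"
        using a b by (auto simp: car)
      then have "h z \<otimes>\<^bsub>L\<^esub> h a = h x \<otimes>\<^bsub>L\<^esub> h a"
        using a b x by (metis mult fib_eq hm Q.m_closed)
      then show "X = fib x" using z x a L.r_cancel hc fib_eq by metis
    qed (use a b x in \<open>auto simp: car mult\<close>)
  qed (auto simp: car one mult Q.m_closed Q.one_closed Q.l_one Q.r_one)
  moreover have "fib \<in> hom Q M" by (auto simp: hom_def car mult)
  moreover have "kernel Q L h = kernel Q M fib"
    unfolding kernel_def one loop_hom_one[OF assms, symmetric] using fib_eq[OF _ Q.one_closed] by blast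
  ultimately show ?thesis
    unfolding normal_subloop_def using kernel_subloop[OF assms] by blast
qed

end

theory Submission
  imports Defs
begin

text \<open>Write \<open>L\<^sub>x\<close> for the left translation by \<open>x\<close>. In a commutative RIF loop squaring is an
  endomorphism, the RIF identity says \<open>L\<^sub>x L\<^sub>s L\<^sub>x = L\<^bsub>x\<^sup>2s\<^esub>\<close> for every square \<open>s\<close>, and an element
  lies in \<open>C\<^sub>0\<close> iff its square is nuclear. Hence the squares form a Moufang loop, and the factor
  loop by \<open>C\<^sub>0\<close> is isomorphic to the loop of squares modulo nuclear elements. As in any commutative
  Moufang loop, \<open>c = x\<^sup>6\<close>, the cube of a square, associates with all squares. So
  \<open>c p = (c p\<^sup>2) p\<^sup>-\<^sup>1 = ((c y\<^sup>2) v\<^sup>2) p\<^sup>-\<^sup>1\<close> for \<open>p = y v\<close>, and expanding the translation by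
  \<open>(c y\<^sup>2) v\<^sup>2\<close> gives \<open>c (y v) = v (c y)\<close>: \<open>c\<close> is nuclear in the whole loop.\<close>

section \<open>Congruences and factor loops\<close>

text \<open>Cancellation for \<open>R\<close> is part of the notion: in an infinite loop,
  compatibility with the product alone does not make division in the factor unique.\<close>

locale loop_congruence = loop +
  fixes R :: "'a \<Rightarrow> 'a \<Rightarrow> bool"
  assumes cong_refl: "a \<in> carrier Q \<Longrightarrow> R a a"
    and cong_sym: "\<lbrakk>a \<in> carrier Q; b \<in> carrier Q; R a b\<rbrakk> \<Longrightarrow> R b a"
    and cong_trans: "\<lbrakk>a \<in> carrier Q; b \<in> carrier Q; c \<in> carrier Q; R a b; R b c\<rbrakk> \<Longrightarrow> R a c"
    and cong_mult: "\<lbrakk>a \<in> carrier Q; b \<in> carrier Q; c \<in> carrier Q; d \<in> carrier Q; R a b; R c d\<rbrakk>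
      \<Longrightarrow> R (a \<otimes> c) (b \<otimes> d)"
    and cong_l_cancel: "\<lbrakk>a \<in> carrier Q; x \<in> carrier Q; y \<in> carrier Q; R (a \<otimes> x) (a \<otimes> y)\<rbrakk> \<Longrightarrow> R x y"
    and cong_r_cancel: "\<lbrakk>a \<in> carrier Q; x \<in> carrier Q; y \<in> carrier Q; R (x \<otimes> a) (y \<otimes> a)\<rbrakk> \<Longrightarrow> R x y"
begin

definition N where "N = {x \<in> carrier Q. R \<one> x}"

text \<open>Right division does the work of associativity: any \<open>x\<close> related to
  \<open>a\<close> is some \<open>n \<otimes> a\<close>, and cancelling \<open>a\<close> puts
  \<open>n\<close> into the class of \<open>\<one>\<close>.\<close>

lemma coset_eq:
  assumes a: "a \<in> carrier Q"
  shows "N #> a = {x \<in> carrier Q. R a x}"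
proof (intro equalityI subsetI)
  fix x assume "x \<in> N #> a"
  then obtain n where n: "n \<in> carrier Q" "R \<one> n" "x = n \<otimes> a"
    by (auto simp: N_def r_coset_def)
  then show "x \<in> {x \<in> carrier Q. R a x}"
    using cong_mult[of \<one> n a a] cong_refl a one_closed l_one m_closed by simp
next
  fix x assume x: "x \<in> {x \<in> carrier Q. R a x}"
  then obtain n where n: "n \<in> carrier Q" "n \<otimes> a = x" using r_div a by blast
  then have "R \<one> n" using cong_r_cancel[of a \<one> n] a x l_one one_closed by simp
  then show "x \<in> N #> a" using n by (auto simp: N_def r_coset_def)
qed

lemma coset_eq_iff:
  assumes "a \<in> carrier Q" "b \<in> carrier Q"
  shows "N #> a = N #> b \<longleftrightarrow> R a b"
  using assms by (auto simp: coset_eq dest: cong_refl cong_sym cong_trans)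

lemma coset_mult:
  assumes a: "a \<in> carrier Q" and b: "b \<in> carrier Q"
  shows "(N #> a) <#> (N #> b) = N #> (a \<otimes> b)"
proof (intro equalityI subsetI)
  fix x assume "x \<in> (N #> a) <#> (N #> b)"
  then show "x \<in> N #> (a \<otimes> b)"
    using a b by (auto simp: coset_eq set_mult_def m_closed intro: cong_mult)
next
  fix x assume "x \<in> N #> (a \<otimes> b)"
  then have x: "x \<in> carrier Q" "R (a \<otimes> b) x" using a b by (auto simp: coset_eq m_closed)
  \<comment> \<open>The representative \<open>b\<close> stays fixed; the other factor absorbs the
    whole deviation of \<open>x\<close> from \<open>a \<otimes> b\<close>.\<close>
  then obtain y where y: "y \<in> carrier Q" "y \<otimes> b = x" using r_div b by blast
  then have "R a y" using cong_r_cancel[of b a y] a b x by simp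
  then show "x \<in> (N #> a) <#> (N #> b)"
    using a b y cong_refl by (auto simp: coset_eq set_mult_def)
qed

lemma coset_one: "N #> \<one> = N"
  by (simp add: coset_eq one_closed) (simp add: N_def)

lemma coset_mult_one:
  assumes "a \<in> carrier Q"
  shows "N <#> (N #> a) = N #> a" and "(N #> a) <#> N = N #> a"
  using assms coset_mult[OF one_closed assms] coset_mult[OF assms one_closed]
  by (simp_all add: coset_one l_one r_one)

text \<open>Solutions come from division in \<open>Q\<close>; their uniqueness is the cancellation
  property of \<open>R\<close>.\<close>

lemma factor_loop: "loop (Q Mod N)"
proof (unfold_locales, goal_cases)
  case (5 A B)
  then obtain a b where a: "a \<in> carrier Q" "A = N #> a" and b: "b \<in> carrier Q" "B = N #> b"
    by (auto simp: carrier_FactGroup)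
  obtain x where x: "x \<in> carrier Q" "a \<otimes> x = b" using l_div a b by blast
  show ?case
  proof (rule ex1I[of _ "N #> x"])
    fix X assume "X \<in> carrier (Q Mod N) \<and> A \<otimes>\<^bsub>Q Mod N\<^esub> X = B"
    then obtain z where z: "z \<in> carrier Q" "X = N #> z"
        and "A <#> X = B"
      by (auto simp: carrier_FactGroup)
    then have "R (a \<otimes> z) (a \<otimes> x)" using a b x by (simp add: coset_mult coset_eq_iff m_closed)
    with z show "X = N #> x" using cong_l_cancel a x by (simp add: coset_eq_iff)
  qed (use a b x in \<open>auto simp: carrier_FactGroup coset_mult\<close>)
next
  case (6 A B)
  then obtain a b where a: "a \<in> carrier Q" "A = N #> a" and b: "b \<in> carrier Q" "B = N #> b"
    by (auto simp: carrier_FactGroup)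
  obtain x where x: "x \<in> carrier Q" "x \<otimes> a = b" using r_div a b by blast
  show ?case
  proof (rule ex1I[of _ "N #> x"])
    fix X assume "X \<in> carrier (Q Mod N) \<and> X \<otimes>\<^bsub>Q Mod N\<^esub> A = B"
    then obtain z where z: "z \<in> carrier Q" "X = N #> z"
        and "X <#> A = B"
      by (auto simp: carrier_FactGroup)
    then have "R (z \<otimes> a) (x \<otimes> a)" using a b x by (simp add: coset_mult coset_eq_iff m_closed)
    with z show "X = N #> x" using cong_r_cancel a x by (simp add: coset_eq_iff)
  qed (use a b x in \<open>auto simp: carrier_FactGroup coset_mult\<close>)
\<comment> \<open>The neutral element of \<open>Q Mod N\<close> is \<open>N\<close> itself, which
  has to be recognised as the coset of \<open>\<one>\<close>.\<close>
qed (auto simp: carrier_FactGroup coset_mult coset_mult_one m_closed l_one r_one imageI[OF one_closed, of "\<lambda>a. N #> a", unfolded coset_one])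

lemma normal_subloop_N: "normal_subloop N Q"
proof -
  have "(\<lambda>a. N #> a) \<in> hom Q (Q Mod N)"
    by (auto simp: hom_def carrier_FactGroup coset_mult)
  moreover have "kernel Q (Q Mod N) (\<lambda>a. N #> a) = N"
  proof -
    have "N #> x = N \<longleftrightarrow> R \<one> x" if "x \<in> carrier Q" for x
      using coset_eq_iff[OF one_closed that] by (auto simp: coset_one)
    then show ?thesis by (auto simp: kernel_def N_def[symmetric]) (auto simp: N_def)
  qed
  ultimately show ?thesis
    using kernel_normal_subloop[OF loop_axioms factor_loop] by metis
qed

end

section \<open>Commutative RIF loops\<close>

locale commutative_RIF_loop = commutative_loop + RIF_loop
begin

section \<open>Inverses\<close>

lemma inv_unique:
  assumes "x \<in> carrier Q" "y \<in> carrier Q" "x \<otimes> y = \<one>" "y \<otimes> x = \<one>"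
  shows "inv x = y"
  unfolding m_inv_def using assms l_cancel[of x] by (intro the_equality) auto

lemma
  assumes x: "x \<in> carrier Q"
  shows inv_closed: "inv x \<in> carrier Q"
    and l_inv: "inv x \<otimes> x = \<one>"
    and r_inv: "x \<otimes> inv x = \<one>"
    and inv_mult_cancel: "y \<in> carrier Q \<Longrightarrow> inv x \<otimes> (x \<otimes> y) = y"
proof -
  obtain x' where x': "x' \<in> carrier Q" "x' \<otimes> x = \<one>" "x \<otimes> x' = \<one>"
      "\<forall>y\<in>carrier Q. x' \<otimes> (x \<otimes> y) = y"
    using inverse_property[OF x] by blast
  then have "inv x = x'" using x by (intro inv_unique)
  then show "inv x \<in> carrier Q" "inv x \<otimes> x = \<one>" "x \<otimes> inv x = \<one>"
      "y \<in> carrier Q \<Longrightarrow> inv x \<otimes> (x \<otimes> y) = y"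
    using x' by auto
qed

lemma inv_inv: "x \<in> carrier Q \<Longrightarrow> inv (inv x) = x"
  by (intro inv_unique inv_closed l_inv r_inv)

lemma mult_inv_cancel: "\<lbrakk>x \<in> carrier Q; y \<in> carrier Q\<rbrakk> \<Longrightarrow> x \<otimes> (inv x \<otimes> y) = y"
  using inv_mult_cancel[of "inv x" y] inv_inv inv_closed by simp

text \<open>Since \<open>x\<close> is \<open>(x \<otimes> y) \<otimes> inv y\<close>, cancelling
  first \<open>x \<otimes> y\<close> and then \<open>x\<close> isolates
  \<open>inv (x \<otimes> y)\<close>.\<close>

lemma inv_mult:
  assumes "x \<in> carrier Q" "y \<in> carrier Q"
  shows "inv (x \<otimes> y) = inv x \<otimes> inv y"
proof -
  have c: "x \<otimes> y \<in> carrier Q" "inv x \<in> carrier Q" "inv y \<in> carrier Q" "inv (x \<otimes> y) \<in> carrier Q"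
    using assms by (simp_all add: m_closed inv_closed)
  have "x = inv y \<otimes> (y \<otimes> x)" using assms by (simp add: inv_mult_cancel)
  also have "\<dots> = (x \<otimes> y) \<otimes> inv y" using assms c by (simp add: m_comm)
  finally have "inv (x \<otimes> y) \<otimes> x = inv y" using inv_mult_cancel[OF c(1,3)] by simp
  then have "x \<otimes> inv (x \<otimes> y) = inv y" using assms c by (simp add: m_comm)
  then show ?thesis using inv_mult_cancel[OF assms(1) c(4)] by simp
qed

section \<open>The RIF identity, squaring and the loop of squares\<close>

lemma RIF_comm:
  assumes "x \<in> carrier Q" "y \<in> carrier Q" "z \<in> carrier Q"
  shows "(x \<otimes> y) \<otimes> ((x \<otimes> y) \<otimes> z) = x \<otimes> (y \<otimes> (y \<otimes> (x \<otimes> z)))"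
  \<comment> \<open>Only one of the two identities is given. Up to commutativity each says that
    translating twice by \<open>x \<otimes> y\<close> is translating by \<open>x\<close>,
    \<open>y\<close>, \<open>y\<close>, \<open>x\<close> in turn; the second is used with
    \<open>x\<close> and \<open>y\<close> exchanged.\<close>
  using RIF
proof
  assume h: "\<forall>x\<in>carrier Q. \<forall>y\<in>carrier Q. \<forall>z\<in>carrier Q.
        ((x \<otimes> y) \<otimes> z) \<otimes> (x \<otimes> y) = x \<otimes> (y \<otimes> ((z \<otimes> x) \<otimes> y))"
  have "(x \<otimes> y) \<otimes> ((x \<otimes> y) \<otimes> z) = ((x \<otimes> y) \<otimes> z) \<otimes> (x \<otimes> y)"
    using assms by (simp add: m_comm m_closed)
  also have "\<dots> = x \<otimes> (y \<otimes> ((z \<otimes> x) \<otimes> y))" using h assms by simp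
  also have "(z \<otimes> x) \<otimes> y = y \<otimes> (x \<otimes> z)" using assms by (metis m_comm m_closed)
  finally show ?thesis .
next
  assume h: "\<forall>x\<in>carrier Q. \<forall>y\<in>carrier Q. \<forall>z\<in>carrier Q.
        (x \<otimes> y) \<otimes> (z \<otimes> (x \<otimes> y)) = ((x \<otimes> (y \<otimes> z)) \<otimes> x) \<otimes> y"
  have "(x \<otimes> y) \<otimes> ((x \<otimes> y) \<otimes> z) = (y \<otimes> x) \<otimes> (z \<otimes> (y \<otimes> x))"
    using assms by (metis m_comm m_closed)
  also have "\<dots> = ((y \<otimes> (x \<otimes> z)) \<otimes> y) \<otimes> x" using h assms by simp
  also have "\<dots> = x \<otimes> (y \<otimes> (y \<otimes> (x \<otimes> z)))" using assms by (metis m_comm m_closed)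
  finally show ?thesis .
qed

text \<open>With \<open>inv y\<close> as third argument of the RIF identity, the inner product on
  one side collapses to \<open>x\<close> and the innermost one on the other side to
  \<open>\<one>\<close>.\<close>

lemma alternative:
  assumes x: "x \<in> carrier Q" and y: "y \<in> carrier Q"
  shows "x \<otimes> (x \<otimes> y) = (x \<otimes> x) \<otimes> y"
proof -
  have "x \<otimes> (x \<otimes> y) = (y \<otimes> x) \<otimes> ((y \<otimes> x) \<otimes> inv y)"
    using x y by (metis m_comm m_closed inv_closed inv_mult_cancel)
  also have "\<dots> = y \<otimes> (x \<otimes> (x \<otimes> (y \<otimes> inv y)))"
    using x y by (intro RIF_comm inv_closed)
  also have "\<dots> = (x \<otimes> x) \<otimes> y"
    using x y by (simp add: r_inv r_one m_comm m_closed)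
  finally show ?thesis .
qed

text \<open>This is the RIF identity at \<open>z = \<one>\<close>, reordered by
  alternativity.\<close>

lemma square_mult:
  assumes x: "x \<in> carrier Q" and y: "y \<in> carrier Q"
  shows "(x \<otimes> y) \<otimes> (x \<otimes> y) = (x \<otimes> x) \<otimes> (y \<otimes> y)"
proof -
  have "(x \<otimes> y) \<otimes> (x \<otimes> y) = x \<otimes> (y \<otimes> (y \<otimes> x))"
    using RIF_comm[OF x y one_closed] x y by (simp add: r_one m_closed)
  also have "\<dots> = x \<otimes> (x \<otimes> (y \<otimes> y))"
    using x y alternative[OF y x] m_comm[OF x] m_comm[of "y \<otimes> y" x] m_closed by metis
  finally show ?thesis using x y by (simp add: alternative m_closed)
qed

definition squares where "squares = (\<lambda>x. x \<otimes> x) ` carrier Q"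

lemma squareI: "x \<in> carrier Q \<Longrightarrow> x \<otimes> x \<in> squares"
  by (simp add: squares_def)

lemma squares_closed: "s \<in> squares \<Longrightarrow> s \<in> carrier Q"
  by (auto simp: squares_def m_closed)

lemma squares_mult: "\<lbrakk>s \<in> squares; t \<in> squares\<rbrakk> \<Longrightarrow> s \<otimes> t \<in> squares"
  unfolding squares_def using square_mult[symmetric] m_closed by fastforce

lemma squares_inv: "s \<in> squares \<Longrightarrow> inv s \<in> squares"
  by (auto simp: squares_def inv_mult inv_closed)

text \<open>Let \<open>y\<close> be a root of \<open>s\<close>. By alternativity the two
  translations by \<open>y\<close> in \<open>RIF_comm\<close> merge into one by \<open>s\<close>,
  and the two by \<open>x \<otimes> y\<close> into one by its square.\<close>

lemma square_bracket:
  assumes x: "x \<in> carrier Q" and s: "s \<in> squares" and z: "z \<in> carrier Q"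
  shows "x \<otimes> (s \<otimes> (x \<otimes> z)) = ((x \<otimes> x) \<otimes> s) \<otimes> z"
proof -
  obtain y where y: "y \<in> carrier Q" "s = y \<otimes> y" using s by (auto simp: squares_def)
  have "((x \<otimes> x) \<otimes> s) \<otimes> z = (x \<otimes> y) \<otimes> ((x \<otimes> y) \<otimes> z)"
    using x y z by (simp add: square_mult[OF x y(1)] alternative m_closed)
  also have "\<dots> = x \<otimes> (s \<otimes> (x \<otimes> z))"
    using RIF_comm[OF x y(1) z] alternative[OF y(1), of "x \<otimes> z"] x y z by (simp add: m_closed)
  finally show ?thesis ..
qed

lemma square_bracket_inv:
  assumes x: "x \<in> carrier Q" and s: "s \<in> squares" and z: "z \<in> carrier Q"
  shows "x \<otimes> (s \<otimes> z) = ((x \<otimes> x) \<otimes> s) \<otimes> (inv x \<otimes> z)"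
  using square_bracket[OF x s, of "inv x \<otimes> z"] x z by (simp add: mult_inv_cancel m_closed inv_closed)

text \<open>Writing \<open>s\<close> as \<open>(s \<otimes> t) \<otimes> inv t\<close> makes
  \<open>square_bracket_inv\<close> produce the factor \<open>inv (x \<otimes> t)\<close>, which
  cancels against \<open>x \<otimes> t\<close>.\<close>

lemma squares_Moufang:
  assumes x: "x \<in> carrier Q" and s: "s \<in> squares" and t: "t \<in> squares"
  shows "(x \<otimes> s) \<otimes> (x \<otimes> t) = x \<otimes> (x \<otimes> (s \<otimes> t))"
proof -
  note c = squares_closed[OF s] squares_closed[OF t]
  have "x \<otimes> s = x \<otimes> ((s \<otimes> t) \<otimes> inv t)"
    using x c by (metis m_comm m_closed inv_closed inv_mult_cancel)
  also have "\<dots> = ((x \<otimes> x) \<otimes> (s \<otimes> t)) \<otimes> (inv x \<otimes> inv t)"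
    using x c s t by (intro square_bracket_inv squares_mult inv_closed)
  also have "\<dots> = inv (x \<otimes> t) \<otimes> (x \<otimes> (x \<otimes> (s \<otimes> t)))"
    using x c alternative[OF x, of "s \<otimes> t"] inv_mult[of x t] m_comm m_closed inv_closed by metis
  finally show ?thesis
    using x c mult_inv_cancel[of "x \<otimes> t"] m_comm m_closed by metis
qed

text \<open>Commutativity allows two expansions of \<open>a \<otimes> (?s \<otimes> ?t)\<close>.
  Comparing them shows that \<open>c\<close> is middle nuclear among the squares, and the inverse
  property turns middle into left.\<close>

lemma cube_square_assoc:
  assumes a: "a \<in> squares" and s: "s \<in> squares" and t: "t \<in> squares"
  defines "c \<equiv> (a \<otimes> a) \<otimes> a"
  shows "c \<otimes> (s \<otimes> t) = (c \<otimes> s) \<otimes> t"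
proof -
  note ca = squares_closed[OF a]
  have c: "c \<in> squares" unfolding c_def by (intro squares_mult a)
  note cc = squares_closed[OF c]
  \<comment> \<open>Three successive translations by \<open>a\<close> amount to one by
    \<open>c\<close>.\<close>
  have c3: "(a \<otimes> a) \<otimes> (a \<otimes> z) = c \<otimes> z" if z: "z \<in> carrier Q" for z
    using square_bracket[OF ca a z] alternative[OF ca, of "a \<otimes> z"] ca z by (simp add: c_def m_closed)
  have swap: "(c \<otimes> s) \<otimes> t = s \<otimes> (c \<otimes> t)" if s: "s \<in> squares" and t: "t \<in> squares" for s t
  proof -
    let ?s = "a \<otimes> s" and ?t = "a \<otimes> t"
    note st = squares_closed[OF s] squares_closed[OF t]
    note sq = squares_mult[OF a s] squares_mult[OF a t]
    note sqc = squares_closed[OF sq(1)] squares_closed[OF sq(2)]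
    have "((a \<otimes> a) \<otimes> ?s) \<otimes> (inv a \<otimes> ?t) = a \<otimes> (?s \<otimes> ?t)"
      using square_bracket_inv[OF ca sq(1) sqc(2)] by simp
    also have "\<dots> = a \<otimes> (?t \<otimes> ?s)" using sqc by (simp add: m_comm)
    also have "\<dots> = ((a \<otimes> a) \<otimes> ?t) \<otimes> (inv a \<otimes> ?s)"
      using square_bracket_inv[OF ca sq(2) sqc(1)] .
    finally show ?thesis
      using ca st cc by (simp add: c3 inv_mult_cancel m_comm m_closed)
  qed
  \<comment> \<open>This is \<open>inv (c \<otimes> s)\<close>, and \<open>c \<otimes> ?q\<close> is
    \<open>inv s\<close>; so \<open>swap\<close> at \<open>?q\<close> and
    \<open>s \<otimes> t\<close> has left side \<open>t\<close>.\<close>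
  let ?q = "inv c \<otimes> inv s"
  note sc = squares_closed[OF s] squares_closed[OF t]
  have q: "?q \<in> squares" by (intro squares_mult squares_inv c s)
  have "(c \<otimes> ?q) \<otimes> (s \<otimes> t) = ?q \<otimes> (c \<otimes> (s \<otimes> t))"
    using s t by (intro swap q squares_mult)
  moreover have "c \<otimes> ?q = inv s" using cc sc by (simp add: mult_inv_cancel inv_closed)
  ultimately have "t = inv (c \<otimes> s) \<otimes> (c \<otimes> (s \<otimes> t))"
    using cc sc by (simp add: inv_mult inv_mult_cancel)
  then show ?thesis using cc sc mult_inv_cancel[of "c \<otimes> s"] m_closed by metis
qed

section \<open>The nucleus and its relation to C elements\<close>

definition left_nucleus where
  "left_nucleus = {c \<in> carrier Q. \<forall>x\<in>carrier Q. \<forall>y\<in>carrier Q. c \<otimes> (x \<otimes> y) = (c \<otimes> x) \<otimes> y}"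

lemma left_nucleusD:
  "\<lbrakk>c \<in> left_nucleus; x \<in> carrier Q; y \<in> carrier Q\<rbrakk> \<Longrightarrow> (c \<otimes> x) \<otimes> y = c \<otimes> (x \<otimes> y)"
  by (simp add: left_nucleus_def)

lemma left_nucleus_closed: "c \<in> left_nucleus \<Longrightarrow> c \<in> carrier Q"
  by (simp add: left_nucleus_def)

text \<open>Together with \<open>left_nucleusD\<close> this moves nuclear factors to the front of a
  product.\<close>

lemma left_nucleus_swap:
  assumes c: "c \<in> left_nucleus" and x: "x \<in> carrier Q" and y: "y \<in> carrier Q"
  shows "x \<otimes> (c \<otimes> y) = c \<otimes> (x \<otimes> y)"
  using left_nucleusD[OF c y x] left_nucleus_closed[OF c] x y by (simp add: m_comm m_closed)

lemma one_left_nucleus: "\<one> \<in> left_nucleus"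
  by (simp add: left_nucleus_def one_closed l_one m_closed)

lemma left_nucleus_mult:
  assumes c: "c \<in> left_nucleus" and d: "d \<in> left_nucleus"
  shows "c \<otimes> d \<in> left_nucleus"
proof -
  have "(c \<otimes> d) \<otimes> (x \<otimes> y) = ((c \<otimes> d) \<otimes> x) \<otimes> y" if "x \<in> carrier Q" "y \<in> carrier Q" for x y
    using c d that by (simp add: left_nucleusD left_nucleus_closed m_closed)
  then show ?thesis using c d by (simp add: left_nucleus_def m_closed)
qed

lemma left_nucleus_inv:
  assumes c: "c \<in> left_nucleus"
  shows "inv c \<in> left_nucleus"
proof -
  \<comment> \<open>Nuclearity of \<open>c\<close> is applied at \<open>inv c \<otimes> x\<close>,
    and then \<open>c\<close> is cancelled.\<close>
  have "inv c \<otimes> (x \<otimes> y) = (inv c \<otimes> x) \<otimes> y" if "x \<in> carrier Q" "y \<in> carrier Q" for x y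
    using left_nucleusD[OF c, of "inv c \<otimes> x" y] left_nucleus_closed[OF c] that
      mult_inv_cancel inv_mult_cancel inv_closed m_closed by metis
  then show ?thesis using left_nucleus_closed[OF c] by (simp add: left_nucleus_def inv_closed)
qed

text \<open>By alternativity the C law for \<open>c\<close> says that \<open>c \<otimes> c\<close>
  is middle nuclear, which in an IP loop is the same as left nuclear.\<close>

lemma C_elements_iff: "c \<in> C\<^sub>0 Q \<longleftrightarrow> c \<in> carrier Q \<and> c \<otimes> c \<in> left_nucleus"
proof (cases "c \<in> carrier Q")
  case c: True
  let ?d = "c \<otimes> c"
  have d: "?d \<in> carrier Q" using c by (simp add: m_closed)
  have "c \<in> C\<^sub>0 Q \<longleftrightarrow> (\<forall>x\<in>carrier Q. \<forall>y\<in>carrier Q. x \<otimes> (?d \<otimes> y) = (?d \<otimes> x) \<otimes> y)"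
  proof -
    have "x \<otimes> (c \<otimes> (c \<otimes> y)) = x \<otimes> (?d \<otimes> y)" "((x \<otimes> c) \<otimes> c) \<otimes> y = (?d \<otimes> x) \<otimes> y"
      if "x \<in> carrier Q" "y \<in> carrier Q" for x y
      using that c alternative[of c] m_comm m_closed by metis+
    then show ?thesis using c by (simp add: C_elements_def)
  qed
  also have "\<dots> \<longleftrightarrow> ?d \<in> left_nucleus"
  proof
    assume h: "\<forall>x\<in>carrier Q. \<forall>y\<in>carrier Q. x \<otimes> (?d \<otimes> y) = (?d \<otimes> x) \<otimes> y"
    have "?d \<otimes> (u \<otimes> w) = (?d \<otimes> u) \<otimes> w" if u: "u \<in> carrier Q" and w: "w \<in> carrier Q" for u w
    proof -
      \<comment> \<open>As in \<open>cube_square_assoc\<close>, this is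
        \<open>inv (?d \<otimes> u)\<close>, and its product with \<open>?d\<close> is
        \<open>inv u\<close>.\<close>
      let ?x = "inv ?d \<otimes> inv u"
      have x: "?x \<in> carrier Q" using d u by (simp add: m_closed inv_closed)
      have "?x \<otimes> (?d \<otimes> (u \<otimes> w)) = (?d \<otimes> ?x) \<otimes> (u \<otimes> w)" using h x u w m_closed by simp
      also have "\<dots> = w" using d u w by (simp add: mult_inv_cancel inv_mult_cancel inv_closed)
      finally have "w = inv (?d \<otimes> u) \<otimes> (?d \<otimes> (u \<otimes> w))" using inv_mult[OF d u] by simp
      then show ?thesis using d u w mult_inv_cancel[of "?d \<otimes> u"] m_closed by metis
    qed
    then show "?d \<in> left_nucleus" using d by (simp add: left_nucleus_def)
  next
    assume n: "?d \<in> left_nucleus"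
    then show "\<forall>x\<in>carrier Q. \<forall>y\<in>carrier Q. x \<otimes> (?d \<otimes> y) = (?d \<otimes> x) \<otimes> y"
      using left_nucleus_swap left_nucleusD by metis
  qed
  finally show ?thesis using c by simp
qed (simp add: C_elements_def)

lemma cube_square_left_nucleus:
  assumes a: "a \<in> squares"
  shows "(a \<otimes> a) \<otimes> a \<in> left_nucleus"
proof -
  define c where "c = (a \<otimes> a) \<otimes> a"
  have c: "c \<in> squares" unfolding c_def by (intro squares_mult a)
  note cc = squares_closed[OF c]
  have "c \<otimes> (y \<otimes> v) = (c \<otimes> y) \<otimes> v" if y: "y \<in> carrier Q" and v: "v \<in> carrier Q" for y v
  proof -
    define p where "p = y \<otimes> v"
    have p: "p \<in> carrier Q" using y v by (simp add: p_def m_closed)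
    \<comment> \<open>A product with \<open>c\<close> is recovered from the square of
      \<open>q\<close>: in \<open>square_bracket\<close> the third argument \<open>inv q\<close>
      cancels the inner \<open>q\<close>.\<close>
    have eval: "((q \<otimes> q) \<otimes> c) \<otimes> inv q = q \<otimes> c" if q: "q \<in> carrier Q" for q
      using square_bracket[OF q c inv_closed[OF q]] q cc by (simp add: r_inv r_one)
    note yy = squareI[OF y] and vv = squareI[OF v]
    have cy: "(y \<otimes> y) \<otimes> c \<in> squares" by (intro squares_mult yy c)
    have "c \<otimes> p = ((p \<otimes> p) \<otimes> c) \<otimes> inv p" using eval[OF p] cc p by (simp add: m_comm)
    also have "(p \<otimes> p) \<otimes> c = c \<otimes> ((y \<otimes> y) \<otimes> (v \<otimes> v))"
      using y v cc by (simp add: p_def square_mult m_comm m_closed)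
    also have "\<dots> = (c \<otimes> (y \<otimes> y)) \<otimes> (v \<otimes> v)"
      unfolding c_def by (rule cube_square_assoc[OF a yy vv])
    also have "\<dots> = (v \<otimes> v) \<otimes> ((y \<otimes> y) \<otimes> c)"
      using y v cc by (simp add: m_comm m_closed)
    \<comment> \<open>Expanding the translation brings a factor \<open>v\<close> next to
      \<open>inv p\<close>; this leaves \<open>inv y\<close>, ready for a second use of
      \<open>eval\<close>.\<close>
    also have "\<dots> \<otimes> inv p = v \<otimes> (((y \<otimes> y) \<otimes> c) \<otimes> (v \<otimes> inv p))"
      using square_bracket[OF v cy inv_closed[OF p]] by simp
    also have "v \<otimes> inv p = inv y"
      using y v by (simp add: p_def inv_mult m_comm[of "inv y"] inv_closed mult_inv_cancel)
    also have "v \<otimes> (((y \<otimes> y) \<otimes> c) \<otimes> inv y) = (c \<otimes> y) \<otimes> v"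
      using eval[OF y] y v cc by (simp add: m_comm m_closed)
    finally show ?thesis by (simp add: p_def)
  qed
  then show ?thesis using cc by (simp add: left_nucleus_def c_def)
qed

text \<open>Squaring is an endomorphism, so the square of the cube of \<open>x\<close> is the cube
  of \<open>x \<otimes> x\<close>, which is nuclear.\<close>

lemma cube_in_C_elements:
  assumes x: "x \<in> carrier Q"
  shows "x [^] (3::nat) \<in> C\<^sub>0 Q"
proof -
  \<comment> \<open>Powers are built up from \<open>\<one>\<close>, so a leading
    \<open>\<one>\<close> has to be removed.\<close>
  have "x [^] (3::nat) = (x \<otimes> x) \<otimes> x"
    using x by (simp add: nat_pow_def numeral_3_eq_3 l_one)
  then show ?thesis
    using cube_square_left_nucleus[OF squareI[OF x]] square_mult[of "x \<otimes> x" x] x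
    by (simp add: C_elements_iff m_closed)
qed

section \<open>The congruence with kernel \<open>C\<^sub>0 Q\<close> and its factor loop\<close>

definition square_cong where
  "square_cong a b \<longleftrightarrow> (\<exists>z\<in>left_nucleus. b \<otimes> b = z \<otimes> (a \<otimes> a))"

text \<open>Squaring splits off \<open>a \<otimes> a\<close>, and the nuclear witness
  \<open>z\<close> can be moved past it.\<close>

lemma square_cong_l_cancel:
  assumes a: "a \<in> carrier Q" and x: "x \<in> carrier Q" and y: "y \<in> carrier Q"
    and h: "square_cong (a \<otimes> x) (a \<otimes> y)"
  shows "square_cong x y"
proof -
  obtain z where z: "z \<in> left_nucleus" "(a \<otimes> a) \<otimes> (y \<otimes> y) = z \<otimes> ((a \<otimes> a) \<otimes> (x \<otimes> x))"
    using h a x y by (auto simp: square_cong_def square_mult)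
  then have "(a \<otimes> a) \<otimes> (y \<otimes> y) = (a \<otimes> a) \<otimes> (z \<otimes> (x \<otimes> x))"
    using a x by (simp add: left_nucleus_swap m_closed)
  then have "y \<otimes> y = z \<otimes> (x \<otimes> x)"
    using l_cancel[of "a \<otimes> a"] a x y left_nucleus_closed[OF z(1)] by (simp add: m_closed)
  then show ?thesis using z by (auto simp: square_cong_def)
qed

text \<open>The relation compares squares modulo the nucleus. It is compatible with products because
  squaring is multiplicative and nuclear factors can be collected in front.\<close>

sublocale square_cong: loop_congruence Q square_cong
proof (unfold_locales, goal_cases)
  case (1 a)
  then show ?case
    unfolding square_cong_def by (intro bexI[OF _ one_left_nucleus]) (simp add: l_one m_closed)
next
  case (2 a b)
  then obtain z where z: "z \<in> left_nucleus" "b \<otimes> b = z \<otimes> (a \<otimes> a)" by (auto simp: square_cong_def)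
  then have "a \<otimes> a = inv z \<otimes> (b \<otimes> b)"
    using 2 left_nucleus_closed by (simp add: inv_mult_cancel m_closed)
  then show ?case using left_nucleus_inv[OF z(1)] by (auto simp: square_cong_def)
next
  case (3 a b c)
  then obtain z w where z: "z \<in> left_nucleus" "b \<otimes> b = z \<otimes> (a \<otimes> a)"
    and w: "w \<in> left_nucleus" "c \<otimes> c = w \<otimes> (b \<otimes> b)"
    by (auto simp: square_cong_def)
  then have "c \<otimes> c = (w \<otimes> z) \<otimes> (a \<otimes> a)"
    using 3 left_nucleus_closed by (simp add: left_nucleusD m_closed)
  then show ?case using left_nucleus_mult[OF w(1) z(1)] by (auto simp: square_cong_def)
next
  case (4 a b c d)
  then obtain z w where z: "z \<in> left_nucleus" "b \<otimes> b = z \<otimes> (a \<otimes> a)"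
    and w: "w \<in> left_nucleus" "d \<otimes> d = w \<otimes> (c \<otimes> c)"
    by (auto simp: square_cong_def)
  then have "(b \<otimes> d) \<otimes> (b \<otimes> d) = (z \<otimes> w) \<otimes> ((a \<otimes> c) \<otimes> (a \<otimes> c))"
    using 4 left_nucleus_closed by (simp add: square_mult left_nucleusD left_nucleus_swap m_closed)
  then show ?case using left_nucleus_mult[OF z(1) w(1)] by (auto simp: square_cong_def)
next
  case (5 a x y)
  then show ?case by (rule square_cong_l_cancel)
next
  case (6 a x y)
  then show ?case using square_cong_l_cancel m_comm by metis
qed

text \<open>Being related to \<open>\<one>\<close> means having a nuclear square, so normality of
  \<open>C\<^sub>0 Q\<close> follows from the general factor construction.\<close>

lemma N_eq_C_elements: "square_cong.N = C\<^sub>0 Q"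
  using left_nucleus_closed
  by (auto simp: square_cong.N_def square_cong_def C_elements_iff l_one r_one one_closed)

text \<open>An identity in the factor loop may thus be checked after squaring both sides, that is,
  among squares.\<close>

lemma square_eq_coset_eq:
  assumes "a \<in> carrier Q" "b \<in> carrier Q" "a \<otimes> a = b \<otimes> b"
  shows "C\<^sub>0 Q #> a = C\<^sub>0 Q #> b"
  unfolding N_eq_C_elements[symmetric] square_cong.coset_eq_iff[OF assms(1,2)] square_cong_def
  using assms by (intro bexI[OF _ one_left_nucleus]) (simp add: l_one m_closed)

lemma factor_Moufang: "Moufang_loop (Q Mod C\<^sub>0 Q)"
proof -
  interpret F: loop "Q Mod C\<^sub>0 Q" using square_cong.factor_loop by (simp add: N_eq_C_elements)
  note C_coset_mult = square_cong.coset_mult[unfolded N_eq_C_elements]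
  have m1: "C\<^sub>0 Q #> (x \<otimes> ((y \<otimes> z) \<otimes> x)) = C\<^sub>0 Q #> ((x \<otimes> y) \<otimes> (z \<otimes> x))"
    and m2: "C\<^sub>0 Q #> ((x \<otimes> (y \<otimes> z)) \<otimes> x) = C\<^sub>0 Q #> ((x \<otimes> y) \<otimes> (z \<otimes> x))"
    and m3: "C\<^sub>0 Q #> (x \<otimes> (y \<otimes> (x \<otimes> z))) = C\<^sub>0 Q #> (((x \<otimes> y) \<otimes> x) \<otimes> z)"
    and m4: "C\<^sub>0 Q #> (((z \<otimes> x) \<otimes> y) \<otimes> x) = C\<^sub>0 Q #> (z \<otimes> (x \<otimes> (y \<otimes> x)))"
    if x: "x \<in> carrier Q" and y: "y \<in> carrier Q" and z: "z \<in> carrier Q" for x y z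
  proof -
    define q where "q a = a \<otimes> a" for a
    have q_mult: "q (a \<otimes> b) = q a \<otimes> q b" if "a \<in> carrier Q" "b \<in> carrier Q" for a b
      using that by (simp add: q_def square_mult)
    have coset: "C\<^sub>0 Q #> a = C\<^sub>0 Q #> b" if "a \<in> carrier Q" "b \<in> carrier Q" "q a = q b" for a b
      using that by (intro square_eq_coset_eq) (simp_all add: q_def)
    have c: "q x \<in> carrier Q" "q y \<in> carrier Q" "q z \<in> carrier Q"
      using x y z by (simp_all add: q_def m_closed)
    have s: "q y \<in> squares" "q z \<in> squares" using y z by (simp_all add: q_def squareI)
    \<comment> \<open>Up to commutativity the first fact gives \<open>e1\<close> and
      \<open>e2\<close>; the second gives \<open>e3\<close> and \<open>e4\<close> with the help of
      alternativity.\<close>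
    note sq = squares_Moufang[OF c(1) s] square_bracket[OF c(1) s(1) c(3)]
    have e1: "q x \<otimes> ((q y \<otimes> q z) \<otimes> q x) = (q x \<otimes> q y) \<otimes> (q z \<otimes> q x)"
      and e2: "(q x \<otimes> (q y \<otimes> q z)) \<otimes> q x = (q x \<otimes> q y) \<otimes> (q z \<otimes> q x)"
      and e3: "q x \<otimes> (q y \<otimes> (q x \<otimes> q z)) = ((q x \<otimes> q y) \<otimes> q x) \<otimes> q z"
      and e4: "((q z \<otimes> q x) \<otimes> q y) \<otimes> q x = q z \<otimes> (q x \<otimes> (q y \<otimes> q x))"
      using sq alternative[OF c(1)] c m_comm m_closed by metis+
    show "C\<^sub>0 Q #> (x \<otimes> ((y \<otimes> z) \<otimes> x)) = C\<^sub>0 Q #> ((x \<otimes> y) \<otimes> (z \<otimes> x))"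
      using x y z by (intro coset) (simp_all add: q_mult e1 m_closed)
    show "C\<^sub>0 Q #> ((x \<otimes> (y \<otimes> z)) \<otimes> x) = C\<^sub>0 Q #> ((x \<otimes> y) \<otimes> (z \<otimes> x))"
      using x y z by (intro coset) (simp_all add: q_mult e2 m_closed)
    show "C\<^sub>0 Q #> (x \<otimes> (y \<otimes> (x \<otimes> z))) = C\<^sub>0 Q #> (((x \<otimes> y) \<otimes> x) \<otimes> z)"
      using x y z by (intro coset) (simp_all add: q_mult e3 m_closed)
    show "C\<^sub>0 Q #> (((z \<otimes> x) \<otimes> y) \<otimes> x) = C\<^sub>0 Q #> (z \<otimes> (x \<otimes> (y \<otimes> x)))"
      using x y z by (intro coset) (simp_all add: q_mult e4 m_closed)
  qed
  show ?thesis
    by unfold_locales (auto simp: carrier_FactGroup C_coset_mult m_closed m1 m2 m3 m4)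
qed

lemma factor_exponent: "has_exponent (Q Mod C\<^sub>0 Q) 3"
  unfolding has_exponent_def
proof
  fix X assume "X \<in> carrier (Q Mod C\<^sub>0 Q)"
  then obtain x where x: "x \<in> carrier Q" "X = C\<^sub>0 Q #> x" by (auto simp: carrier_FactGroup)
  note coset = square_cong.coset_mult square_cong.coset_one square_cong.coset_mult_one
  note C_coset = coset[unfolded N_eq_C_elements]
  \<comment> \<open>Here the power starts from the neutral coset \<open>C\<^sub>0 Q\<close>, which
    the next factor absorbs.\<close>
  have X: "X [^]\<^bsub>Q Mod C\<^sub>0 Q\<^esub> (3::nat) = C\<^sub>0 Q #> (x [^] (3::nat))"
    using x by (simp add: nat_pow_def numeral_3_eq_3 C_coset m_closed l_one)
  have "square_cong \<one> (x [^] (3::nat))"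
    using cube_in_C_elements[OF x(1)] by (simp add: N_eq_C_elements[symmetric] square_cong.N_def)
  moreover have "x [^] (3::nat) \<in> carrier Q"
    using cube_in_C_elements[OF x(1)] by (simp add: C_elements_def)
  ultimately have "C\<^sub>0 Q #> (x [^] (3::nat)) = C\<^sub>0 Q #> \<one>"
    using square_cong.coset_eq_iff[OF one_closed] by (metis N_eq_C_elements)
  then show "X [^]\<^bsub>Q Mod C\<^sub>0 Q\<^esub> (3::nat) = \<one>\<^bsub>Q Mod C\<^sub>0 Q\<^esub>"
    by (simp add: X C_coset)
qed

end

theorem theorem4p7:
  fixes Q :: "('a, 'b) monoid_scheme"
  assumes "commutative_loop Q" and "RIF_loop Q"
  shows "(\<forall>x\<in>carrier Q. x [^]\<^bsub>Q\<^esub> (3::nat) \<in> C\<^sub>0 Q) \<and>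
         normal_subloop (C\<^sub>0 Q) Q \<and>
         Moufang_loop (Q Mod C\<^sub>0 Q) \<and> has_exponent (Q Mod C\<^sub>0 Q) 3"
proof -
  interpret commutative_RIF_loop Q using assms by (rule commutative_RIF_loop.intro)
  show ?thesis
    using cube_in_C_elements square_cong.normal_subloop_N factor_Moufang factor_exponent
    by (simp add: N_eq_C_elements)
qed

end
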